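(* Let $G=(V,E)$ be a finite simple connected graph. Then $\beth^{1}(K^{h(G)})\le \beth^{1}(G)$; that is, $$\binom{h(G)}{2}-\binom{h(G)}{1}\le |E|-|V|.$$
   Context: All graphs are finite and simple. $K^{t}$ is the complete graph on $t$ vertices. The Hadwiger number $h(G)$ is the maximum $t$ such that $K^{t}$ is a minor of $G$. For a connected graph $G$, the first graph characteristic is $\beth^{1}(G)=|E(G)|-|V(G)|$. *)

theory Defs
  imports Main "HOL-Library.Disjoint_Sets"
begin

record 'a ugraph =
  verts :: "'a set"
  edges :: "'a set set"

definition simple_graph :: "'a ugraph \<Rightarrow> bool" where
  "simple_graph G \<longleftrightarrow> finite (verts G) \<and> (\<forall>e\<in>edges G. e \<subseteq> verts G \<and> card e = 2)"

definition subgraph :: "'a ugraph \<Rightarrow> 'a ugraph \<Rightarrow> bool" where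
  "subgraph H G \<longleftrightarrow> simple_graph H \<and> verts H \<subseteq> verts G \<and> edges H \<subseteq> edges G"

definition induced :: "'a ugraph \<Rightarrow> 'a set \<Rightarrow> 'a ugraph" where
  "induced G S = \<lparr>verts = verts G \<inter> S, edges = {e \<in> edges G. e \<subseteq> S}\<rparr>"

text \<open>A connected graph is nonempty, so the branch sets below are nonempty too.\<close>

definition connected_graph :: "'a ugraph \<Rightarrow> bool" where
  "connected_graph G \<longleftrightarrow> verts G \<noteq> {} \<and>
     (\<forall>u\<in>verts G. \<forall>v\<in>verts G. (u, v) \<in> {(x, y). {x, y} \<in> edges G}\<^sup>*)"

text \<open>Minors are defined as in Diestel's textbook: \<open>G\<close> is an inflation of \<open>X\<close> if its vertex set
  is partitioned into connected branch sets \<open>B x\<close>, one for each vertex \<open>x\<close> of \<open>X\<close>, such that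
  contracting every branch set to a single vertex yields \<open>X\<close>; and \<open>X\<close> is a minor of \<open>Y\<close> if \<open>Y\<close>
  has a subgraph that is an inflation of \<open>X\<close>. The vertex types may differ, so that being a minor
  is invariant under isomorphism.\<close>

definition inflation_of :: "'b ugraph \<Rightarrow> 'a ugraph \<Rightarrow> bool" where
  "inflation_of X G \<longleftrightarrow> (\<exists>B :: 'b \<Rightarrow> 'a set.
     (\<Union>x\<in>verts X. B x) = verts G \<and>
     disjoint_family_on B (verts X) \<and>
     (\<forall>x\<in>verts X. connected_graph (induced G (B x))) \<and>
     (\<forall>x\<in>verts X. \<forall>y\<in>verts X. x \<noteq> y \<longrightarrow>
        ({x, y} \<in> edges X \<longleftrightarrow> (\<exists>u\<in>B x. \<exists>v\<in>B y. {u, v} \<in> edges G))))"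

definition minor :: "'b ugraph \<Rightarrow> 'a ugraph \<Rightarrow> bool" where
  "minor X Y \<longleftrightarrow> (\<exists>G. subgraph G Y \<and> inflation_of X G)"

definition complete_graph :: "nat \<Rightarrow> nat ugraph" where
  "complete_graph t = \<lparr>verts = {..<t}, edges = {e. e \<subseteq> {..<t} \<and> card e = 2}\<rparr>"

definition hadwiger :: "'a ugraph \<Rightarrow> nat" where
  "hadwiger G = Max {t. minor (complete_graph t) G}"

definition beth1 :: "'a ugraph \<Rightarrow> int" where
  "beth1 G = int (card (edges G)) - int (card (verts G))"

lemma minor_complete_graph_le_card:
  assumes "simple_graph G" and "minor (complete_graph t) G"
  shows "t \<le> card (verts G)"
proof -
  obtain H B where H: "subgraph H G" and U: "(\<Union>x<t. B x) = verts H"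
    and D: "disjoint_family_on B {..<t}"
    and C: "\<forall>x<t. connected_graph (induced H (B x))"
    using assms(2) unfolding minor_def inflation_of_def complete_graph_def ugraph.simps Ball_def lessThan_iff
    by (elim exE conjE) (rule that)
  have ne: "\<exists>v. v \<in> B x" if "x < t" for x
    using C that by (auto simp: connected_graph_def induced_def)
  define f where "f x = (SOME v. v \<in> B x)" for x
  have f: "f x \<in> B x" if "x < t" for x
    unfolding f_def using ne[OF that] by (rule someI_ex)
  have "inj_on f {..<t}"
  proof (rule inj_onI, rule ccontr)
    fix x y assume xy: "x \<in> {..<t}" "y \<in> {..<t}" "f x = f y" "x \<noteq> y"
    have "B x \<inter> B y = {}"
      using D xy(1,2,4) by (rule disjoint_family_onD)
    moreover have "f x \<in> B x" "f x \<in> B y"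
      using f[of x] f[of y] xy by simp_all
    ultimately show False by blast
  qed
  moreover have "f ` {..<t} \<subseteq> verts G"
    using f U H unfolding subgraph_def by blast
  moreover have "finite (verts G)"
    using assms(1) by (simp add: simple_graph_def)
  ultimately show ?thesis
    using card_inj_on_le[of f "{..<t}" "verts G"] by simp
qed

text \<open>The maximum in the definition of \<^const>\<open>hadwiger\<close> is therefore attained.\<close>

lemma minor_complete_graph_hadwiger:
  assumes "simple_graph G"
  shows "minor (complete_graph (hadwiger G)) G"
    and "minor (complete_graph t) G \<Longrightarrow> t \<le> hadwiger G"
proof -
  let ?T = "{t. minor (complete_graph t) G}"
  have fin: "finite ?T"
    by (rule finite_subset[of _ "{..card (verts G)}"])
      (auto dest: minor_complete_graph_le_card[OF assms])
  have "subgraph \<lparr>verts = {}, edges = {}\<rparr> G"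
    by (simp add: subgraph_def simple_graph_def)
  moreover have "inflation_of (complete_graph 0) \<lparr>verts = {} :: 'a set, edges = {}\<rparr>"
    by (simp add: inflation_of_def complete_graph_def disjoint_family_on_def)
  ultimately have "0 \<in> ?T"
    by (auto simp: minor_def)
  then show "minor (complete_graph (hadwiger G)) G"
    unfolding hadwiger_def using Max_in[OF fin] by blast
  show "t \<le> hadwiger G" if "minor (complete_graph t) G"
    unfolding hadwiger_def using Max_ge[OF fin] that by blast
qed

end

(* Take a subgraph H of G that is an inflation of the complete graph on t = h(G) vertices.
   Growing a vertex set S one vertex at a time in a connected graph meets a new edge at every step,
   so a connected graph has at least |V| - |S| edges that do not lie inside S.  Applied to
   S = V(H) this gives |V| - |V(H)| edges of G outside H; applied to a single vertex of each branch
   set B it gives |B| - 1 edges inside B, hence |V(H)| - t edges of H inside branch sets.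
   The pairs of branch sets contribute another (t choose 2) edges. *)
theory Submission
  imports Defs
begin

lemma finite_edges: "simple_graph G \<Longrightarrow> finite (edges G)"
  by (rule finite_subset[of _ "Pow (verts G)"]) (auto simp: simple_graph_def)

lemma simple_graph_induced: "simple_graph G \<Longrightarrow> simple_graph (induced G S)"
  by (auto simp: simple_graph_def induced_def)

text \<open>A walk from a vertex of \<open>S\<close> to a vertex outside must leave \<open>S\<close>
  at some step; the induction along the reflexive transitive closure finds that step.\<close>

lemma connected_graph_crossing_edge:
  assumes "connected_graph G" and "S \<noteq> {}" and "S \<subset> verts G"
  obtains u v where "u \<in> S" and "v \<notin> S" and "{u, v} \<in> edges G"
proof -
  obtain a b where ab: "a \<in> S" "b \<in> verts G" "b \<notin> S"
    using assms by blast
  then have "(a, b) \<in> {(x, y). {x, y} \<in> edges G}\<^sup>*"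
    using assms by (auto simp: connected_graph_def)
  then have "b \<notin> S \<longrightarrow> (\<exists>u v. u \<in> S \<and> v \<notin> S \<and> {u, v} \<in> edges G)"
    by induction (use ab in auto)
  with ab that show thesis by blast
qed

lemma card_verts_le_edges_outside:
  assumes G: "simple_graph G" "connected_graph G" and "S \<noteq> {}" and "S \<subseteq> verts G"
  shows "card (verts G) \<le> card S + card {e \<in> edges G. \<not> e \<subseteq> S}"
  using assms(3,4)
proof (induction "card (verts G - S)" arbitrary: S rule: less_induct)
  case less
  have fin: "finite (verts G)" "finite S"
    using G less.prems by (auto simp: simple_graph_def intro: finite_subset)
  show ?case
  proof (cases "S = verts G")
    case False
    with less.prems obtain u v where uv: "u \<in> S" "v \<notin> S" "{u, v} \<in> edges G"
      using connected_graph_crossing_edge[OF G(2)] by blast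
    have v: "v \<in> verts G"
      using G(1) uv(3) by (auto simp: simple_graph_def)
    have "card (verts G - insert v S) < card (verts G - S)"
      using v uv(2) fin by (intro psubset_card_mono) auto
    then have "card (verts G) \<le> card (insert v S) + card {e \<in> edges G. \<not> e \<subseteq> insert v S}"
      using less.prems v by (intro less.hyps) auto
    \<comment> \<open>The crossing edge \<open>{u, v}\<close> lies inside \<open>insert v S\<close>
      but not inside \<open>S\<close>. This strict drop pays for the added vertex
      \<open>v\<close>.\<close>
    moreover have "card {e \<in> edges G. \<not> e \<subseteq> insert v S} < card {e \<in> edges G. \<not> e \<subseteq> S}"
    proof (rule psubset_card_mono)
      have "{u, v} \<in> {e \<in> edges G. \<not> e \<subseteq> S} - {e \<in> edges G. \<not> e \<subseteq> insert v S}"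
        using uv by simp
      then show "{e \<in> edges G. \<not> e \<subseteq> insert v S} \<subset> {e \<in> edges G. \<not> e \<subseteq> S}"
        by blast
    qed (simp add: finite_edges[OF G(1)])
    ultimately show ?thesis
      using uv(2) fin by simp
  qed simp
qed

lemma card_verts_le_Suc_edges:
  assumes "simple_graph G" and "connected_graph G"
  shows "card (verts G) \<le> Suc (card (edges G))"
proof -
  obtain v where "v \<in> verts G"
    using assms(2) by (auto simp: connected_graph_def)
  then have "card (verts G) \<le> card {v} + card {e \<in> edges G. \<not> e \<subseteq> {v}}"
    by (intro card_verts_le_edges_outside[OF assms]) auto
  also have "card {e \<in> edges G. \<not> e \<subseteq> {v}} \<le> card (edges G)"
    using finite_edges[OF assms(1)] by (auto intro: card_mono)
  finally show ?thesis by simp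
qed

text \<open>The edges inside branch sets and those joining two branch sets are disjoint families, so
  their lower bounds add up. Moving \<open>t\<close> to the right avoids subtraction on
  naturals.\<close>

lemma inflation_complete_graph_card:
  assumes H: "simple_graph H" and "inflation_of (complete_graph t) H"
  shows "card (verts H) + (t choose 2) \<le> card (edges H) + t"
proof -
  obtain B where U: "(\<Union>x<t. B x) = verts H"
    and D: "disjoint_family_on B {..<t}"
    and C: "\<And>x. x < t \<Longrightarrow> connected_graph (induced H (B x))"
    and A: "\<And>x y. x < t \<Longrightarrow> y < t \<Longrightarrow> x \<noteq> y \<Longrightarrow> \<exists>u\<in>B x. \<exists>v\<in>B y. {u, v} \<in> edges H"
    using assms(2) unfolding inflation_of_def complete_graph_def by (auto simp: Ball_def)
  define I where "I x = edges (induced H (B x))" for x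
  \<comment> \<open>The index of the branch set containing \<open>v\<close>, unique by disjointness.
    An edge is then classified by its image under \<open>i\<close>: one index if inside a branch
    set, two if it joins different ones.\<close>
  define i where "i v = (THE x. x < t \<and> v \<in> B x)" for v
  have i: "i v = x" if "x < t" "v \<in> B x" for v x
    unfolding i_def using that D by (intro the_equality) (auto simp: disjoint_family_on_def)
  have fin: "finite (verts H)" "finite (edges H)"
    using H by (auto simp: simple_graph_def intro: finite_edges[OF H])
  have i_I: "i ` e = {x}" if "x < t" "e \<in> I x" for x e
  proof -
    have "e \<subseteq> B x" "card e = 2"
      using that H by (auto simp: I_def induced_def simple_graph_def)
    \<comment> \<open>Nonemptiness makes the image exactly \<open>{x}\<close> rather than just a
      subset of it.\<close>
    moreover from this(2) have "e \<noteq> {}" by auto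
    ultimately show ?thesis using i that(1) by blast
  qed
  define X where "X = {e \<in> edges H. card (i ` e) = 2}"
  have "(t choose 2) = card {p. p \<subseteq> {..<t} \<and> card p = 2}"
    by (simp add: n_subsets)
  also have "\<dots> \<le> card X"
  \<comment> \<open>Each pair of indices is the image of some edge joining the two branch sets, so
    \<open>X\<close> has at least as many elements as there are pairs.\<close>
  proof (rule surj_card_le[where f = "\<lambda>e. i ` e"])
    show "{p. p \<subseteq> {..<t} \<and> card p = 2} \<subseteq> (\<lambda>e. i ` e) ` X"
    proof
      fix p assume "p \<in> {p. p \<subseteq> {..<t} \<and> card p = 2}"
      then obtain x y where xy: "p = {x, y}" "x \<noteq> y" "x < t" "y < t"
        by (auto simp: card_2_iff)
      with A obtain u v where "u \<in> B x" "v \<in> B y" "{u, v} \<in> edges H" by metis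
      with xy i have "i ` {u, v} = p" "{u, v} \<in> X" by (auto simp: X_def)
      then show "p \<in> (\<lambda>e. i ` e) ` X" by blast
    qed
  qed (use fin in \<open>simp add: X_def\<close>)
  finally have X: "(t choose 2) \<le> card X" .
  have "finite (B x)" if "x < t" for x
    using that U by (intro finite_subset[OF _ fin(1)]) auto
  then have "card (verts H) = (\<Sum>x<t. card (B x))"
    unfolding U[symmetric] using D
    by (intro card_UN_disjoint) (auto simp: disjoint_family_on_def)
  also have "\<dots> \<le> (\<Sum>x<t. Suc (card (I x)))"
  proof (rule sum_mono)
    fix x assume x: "x \<in> {..<t}"
    then have "verts (induced H (B x)) = B x"
      using U by (auto simp: induced_def)
    with card_verts_le_Suc_edges[OF simple_graph_induced[OF H] C[of x]] x
    show "card (B x) \<le> Suc (card (I x))" by (simp add: I_def)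
  qed
  also have "\<dots> = card (\<Union>x<t. I x) + t"
  proof -
    have "card (\<Union>x<t. I x) = (\<Sum>x<t. card (I x))"
    proof (rule card_UN_disjoint)
      show "\<forall>x\<in>{..<t}. finite (I x)"
        using fin by (simp add: I_def induced_def)
      show "\<forall>x\<in>{..<t}. \<forall>y\<in>{..<t}. x \<noteq> y \<longrightarrow> I x \<inter> I y = {}"
        \<comment> \<open>A common edge would have both \<open>{x}\<close> and \<open>{y}\<close> as
          its image under \<open>i\<close>.\<close>
        using i_I by (metis disjoint_iff lessThan_iff singleton_inject)
    qed simp
    then show ?thesis by (simp add: sum_Suc)
  qed
  finally have "card (verts H) + (t choose 2) \<le> card (\<Union>x<t. I x) + card X + t"
    using X by simp
  also have "card (\<Union>x<t. I x) + card X = card ((\<Union>x<t. I x) \<union> X)"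
  proof (rule card_Un_disjoint[symmetric])
    show "finite (\<Union>x<t. I x)" "finite X"
      using fin by (simp_all add: I_def X_def induced_def)
    show "(\<Union>x<t. I x) \<inter> X = {}"
      by (auto simp: X_def dest: i_I)
  qed
  also have "\<dots> \<le> card (edges H)"
    using fin by (intro card_mono) (auto simp: I_def X_def induced_def)
  finally show ?thesis by simp
qed

text \<open>A single vertex is an inflation of the complete graph on one vertex. Positivity ensures
  that the inflation inside \<open>G\<close> is nonempty, as growing from its vertex set
  requires.\<close>

lemma hadwiger_pos:
  assumes "simple_graph G" and "verts G \<noteq> {}"
  shows "0 < hadwiger G"
proof -
  obtain v where "v \<in> verts G" using assms by blast
  then have "subgraph \<lparr>verts = {v}, edges = {}\<rparr> G"
    by (simp add: subgraph_def simple_graph_def)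
  moreover have "inflation_of (complete_graph 1) \<lparr>verts = {v}, edges = {}\<rparr>"
    unfolding inflation_of_def
    by (rule exI[of _ "\<lambda>_. {v}"])
      (auto simp: complete_graph_def disjoint_family_on_def connected_graph_def induced_def)
  ultimately have "minor (complete_graph 1) G"
    by (auto simp: minor_def)
  from minor_complete_graph_hadwiger(2)[OF assms(1) this] show ?thesis by simp
qed

lemma beth1_complete_graph: "beth1 (complete_graph t) = int (t choose 2) - int (t choose 1)"
  by (simp add: beth1_def complete_graph_def n_subsets)

theorem corollary2p1p1:
  fixes G :: "'a ugraph"
  assumes "simple_graph G" and "connected_graph G"
  shows "beth1 (complete_graph (hadwiger G)) \<le> beth1 G \<and>
    int (hadwiger G choose 2) - int (hadwiger G choose 1)
      \<le> int (card (edges G)) - int (card (verts G))"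
proof -
  define t where "t = hadwiger G"
  obtain H where H: "subgraph H G" and infl: "inflation_of (complete_graph t) H"
    using minor_complete_graph_hadwiger(1)[OF assms(1)] unfolding t_def minor_def by blast
  have sH: "simple_graph H" and sub: "verts H \<subseteq> verts G" "edges H \<subseteq> edges G"
    using H by (auto simp: subgraph_def)
  have "0 < t"
    unfolding t_def using assms by (intro hadwiger_pos) (auto simp: connected_graph_def)
  then have "verts H \<noteq> {}"
    using infl by (fastforce simp: inflation_of_def complete_graph_def connected_graph_def induced_def)
  let ?F = "{e \<in> edges G. \<not> e \<subseteq> verts H}"
  have "card (verts G) \<le> card (verts H) + card ?F"
    by (rule card_verts_le_edges_outside) fact+
  moreover have "card (edges H) + card ?F \<le> card (edges G)"
  proof -
    \<comment> \<open>Edges of \<open>H\<close> have both ends in \<open>verts H\<close>, so none of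
      them belongs to \<open>?F\<close>.\<close>
    have "card (edges H) + card ?F = card (edges H \<union> ?F)"
      using finite_edges[OF assms(1)] finite_edges[OF sH] sH
      by (intro card_Un_disjoint[symmetric]) (auto simp: simple_graph_def)
    also have "\<dots> \<le> card (edges G)"
      using finite_edges[OF assms(1)] sub by (intro card_mono) auto
    finally show ?thesis .
  qed
  moreover have "card (verts H) + (t choose 2) \<le> card (edges H) + t"
    using sH infl by (rule inflation_complete_graph_card)
  \<comment> \<open>Adding the three bounds cancels \<open>card (verts H)\<close>,
    \<open>card (edges H)\<close> and \<open>card ?F\<close>; here \<open>t choose 1\<close> is
    \<open>t\<close>.\<close>
  ultimately have "int (t choose 2) - int (t choose 1) \<le> int (card (edges G)) - int (card (verts G))"
    by simp
  then show ?thesis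
    unfolding beth1_complete_graph t_def beth1_def[of G] by blast
qed

end
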